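(* Let $\mathcal{H}$ be a subgroup of a group $\mathcal{G}$ and $\mathcal{C}$ a proper subset of $\mathcal{H}$. Suppose that no map from $\{0,1\}\times(\mathcal{H}\setminus\mathcal{C})\times(\mathcal{G}/\mathcal{H})$ to $\mathcal{C}$ is surjective. Then $\mathcal{C}$ is not a minimal left complement in $\mathcal{G}$, i.e. there is no subset $\mathcal{S}$ of $\mathcal{G}$ to which $\mathcal{C}$ is a minimal left complement.
   Context: For subsets $A,B$ of a group $G$, $A\cdot B=\{ab: a\in A,b\in B\}$. $A$ is a left complement to $B$ if $A\cdot B=G$; it is a minimal left complement to $B$ if moreover no proper subset of $A$ is a left complement to $B$. $\mathcal{G}/\mathcal{H}$ denotes the set of cosets of $\mathcal{H}$ in $\mathcal{G}$. *)

theory Defs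
  imports "HOL-Algebra.Left_Coset"
begin

definition left_complement :: "('a, 'b) monoid_scheme \<Rightarrow> 'a set \<Rightarrow> 'a set \<Rightarrow> bool" where
  "left_complement G A B \<longleftrightarrow>
     A \<subseteq> carrier G \<and> B \<subseteq> carrier G \<and> A <#>\<^bsub>G\<^esub> B = carrier G"

definition minimal_left_complement :: "('a, 'b) monoid_scheme \<Rightarrow> 'a set \<Rightarrow> 'a set \<Rightarrow> bool" where
  "minimal_left_complement G A B \<longleftrightarrow>
     left_complement G A B \<and> (\<forall>A'. A' \<subset> A \<longrightarrow> \<not> left_complement G A' B)"

end

theory Submission
  imports Defs
begin

text \<open>Suppose \<open>C S = G\<close> with \<open>C\<close> minimal. Each \<open>c \<in> C\<close> has a witness \<open>g\<^sub>c\<close> which is reached from \<open>S\<close> only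
  through \<open>c\<close>, so \<open>g\<^sub>c t\<inverse> \<in> H - C\<close> for every \<open>t \<in> S \<inter> H g\<^sub>c\<close> other than \<open>c\<inverse> g\<^sub>c\<close>. As \<open>C \<noteq> H\<close>, every right
  coset of \<open>H\<close> contains two distinct elements \<open>t\<^sub>0, t\<^sub>1\<close> of \<open>S\<close>, and for one of them \<open>g\<^sub>c t\<^sub>i\<inverse> \<in> H - C\<close>. The
  triple of \<open>i\<close>, \<open>g\<^sub>c t\<^sub>i\<inverse>\<close> and the coset determines \<open>g\<^sub>c\<close> and hence \<open>c\<close>. Right cosets \<open>H g\<close> are
  encoded by the left cosets \<open>g\<inverse> H\<close>.\<close>

text \<open>Deleting \<open>c\<close> from \<open>C\<close> must lose some \<open>g\<close>; as
  \<open>C\<close> and \<open>S\<close> together still reach \<open>g\<close>, every factorization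
  of it uses \<open>c\<close>.\<close>

lemma minimal_left_complement_witness:
  assumes min: "minimal_left_complement G C S" and c: "c \<in> C"
  obtains g s where "g \<in> carrier G" "s \<in> S" "g = c \<otimes>\<^bsub>G\<^esub> s"
    "\<And>c' s'. c' \<in> C \<Longrightarrow> s' \<in> S \<Longrightarrow> g = c' \<otimes>\<^bsub>G\<^esub> s' \<Longrightarrow> c' = c"
proof -
  have CS: "C \<subseteq> carrier G" "S \<subseteq> carrier G" and eq: "C <#>\<^bsub>G\<^esub> S = carrier G"
    using min by (auto simp: minimal_left_complement_def left_complement_def)
  have "\<not> left_complement G (C - {c}) S"
    using min c by (auto simp: minimal_left_complement_def)
  then have ne: "(C - {c}) <#>\<^bsub>G\<^esub> S \<noteq> carrier G"
    using CS by (auto simp: left_complement_def)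
  have "(C - {c}) <#>\<^bsub>G\<^esub> S \<subseteq> carrier G"
    using eq by (auto simp: set_mult_def)
  with ne obtain g where g: "g \<in> carrier G" "g \<notin> (C - {c}) <#>\<^bsub>G\<^esub> S"
    by blast
  have uniq: "c' = c" if "c' \<in> C" "s' \<in> S" "g = c' \<otimes>\<^bsub>G\<^esub> s'" for c' s'
    using g(2) that by (auto simp: set_mult_def)
  have "g \<in> C <#>\<^bsub>G\<^esub> S"
    using g(1) eq by simp
  then obtain c' s where "c' \<in> C" "s \<in> S" "g = c' \<otimes>\<^bsub>G\<^esub> s"
    by (auto simp: set_mult_def)
  with uniq g(1) that show thesis
    by blast
qed

text \<open>If a right coset of \<open>H\<close> held only one \<open>t\<close> from
  \<open>S\<close>, it would have to be covered by the translate of \<open>C\<close> by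
  \<open>t\<close>, which is too small because \<open>C\<close> is a proper subset of
  \<open>H\<close>.\<close>

lemma (in group) left_complement_meets_coset_twice:
  assumes H: "subgroup H G" and CH: "C \<subset> H" and comp: "left_complement G C S"
    and K: "K \<in> lcosets H"
  obtains t u where "t \<in> S" "u \<in> S" "t \<noteq> u" "inv t \<in> K" "inv u \<in> K"
proof -
  interpret H: subgroup H G by (rule H)
  have S: "S \<subseteq> carrier G" and eq: "C <#> S = carrier G"
    using comp by (auto simp: left_complement_def)
  obtain x where x: "x \<in> carrier G" and Kx: "K = x <# H"
    using K by (auto simp: LCOSETS_def)
  \<comment> \<open>The elements \<open>h \<otimes> inv x\<close> form the right coset of inverses
    of \<open>K\<close>. Since \<open>c\<close> lies in \<open>H\<close>, the factor
    \<open>s\<close> stays in that coset.\<close>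
  have ex: "\<exists>c\<in>C. \<exists>s\<in>S. h \<otimes> inv x = c \<otimes> s \<and> inv s \<in> K" if h: "h \<in> H" for h
  proof -
    have "h \<otimes> inv x \<in> C <#> S"
      using eq x h by simp
    then obtain c s where cs: "c \<in> C" "s \<in> S" "h \<otimes> inv x = c \<otimes> s"
      by (auto simp: set_mult_def)
    have cH: "c \<in> H" and sG: "s \<in> carrier G"
      using cs CH S by auto
    have "s = inv c \<otimes> (h \<otimes> inv x)"
      using cs(3) cH sG by (simp add: m_assoc [symmetric])
    then have "inv s = x \<otimes> (inv h \<otimes> c)"
      using cH h x by (simp add: inv_mult_group m_assoc)
    moreover have "inv h \<otimes> c \<in> H"
      using cH h by simp
    ultimately have "inv s \<in> K"
      by (auto simp: Kx l_coset_def)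
    with cs show ?thesis by blast
  qed
  obtain t where t: "t \<in> S" "inv t \<in> K"
    using ex [OF H.one_closed] by blast
  have tG: "t \<in> carrier G" using t S by auto
  obtain k where k: "k \<in> H" "inv t = x \<otimes> k"
    using t by (auto simp: Kx l_coset_def)
  obtain d where d: "d \<in> H" "d \<notin> C"
    using CH by auto
  \<comment> \<open>The element factored here is \<open>d \<otimes> t\<close>; \<open>u = t\<close>
    would give \<open>d = c\<close> by cancellation, although \<open>d\<close> is outside
    \<open>C\<close>.\<close>
  obtain c u where u: "c \<in> C" "u \<in> S" "(d \<otimes> inv k) \<otimes> inv x = c \<otimes> u" "inv u \<in> K"
    using ex [of "d \<otimes> inv k"] d k by auto
  have "t = inv k \<otimes> inv x"
    using k x tG by (metis H.mem_carrier inv_inv inv_mult_group)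
  then have "d \<otimes> t = c \<otimes> u"
    using u(3) d k x by (simp add: m_assoc)
  then have "t \<noteq> u"
    using u d CH tG by (metis H.mem_carrier psubsetD right_cancel)
  with t u that show thesis by blast
qed

theorem theorem2p23:
  fixes G :: "('a, 'b) monoid_scheme" and H C :: "'a set"
  assumes "group G"
    and "subgroup H G"
    and "C \<subset> H"
    and "\<not> (\<exists>f :: nat \<times> 'a \<times> 'a set \<Rightarrow> 'a.
               f ` ({0, 1} \<times> (H - C) \<times> (lcosets\<^bsub>G\<^esub> H)) = C)"
  shows "\<not> (\<exists>S. S \<subseteq> carrier G \<and> minimal_left_complement G C S)"
proof
  assume "\<exists>S. S \<subseteq> carrier G \<and> minimal_left_complement G C S"
  then obtain S where min: "minimal_left_complement G C S"
    by blast
  interpret group G by (rule assms(1))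
  interpret H: subgroup H G by (rule assms(2))
  let ?X = "{0, 1 :: nat} \<times> (H - C) \<times> (lcosets\<^bsub>G\<^esub> H)"
  have comp: "left_complement G C S"
    using min by (simp add: minimal_left_complement_def)
  then have S: "S \<subseteq> carrier G" and "C \<noteq> {}"
    using one_closed by (auto simp: left_complement_def set_mult_def)
  \<comment> \<open>Default value for the surjection \<open>f\<close> built at the end.\<close>
  then obtain c0 where c0: "c0 \<in> C" by blast
  have "\<forall>c\<in>C. \<exists>s. s \<in> S \<and> c \<otimes>\<^bsub>G\<^esub> s \<in> carrier G \<and>
      (\<forall>c'\<in>C. \<forall>s'\<in>S. c \<otimes>\<^bsub>G\<^esub> s = c' \<otimes>\<^bsub>G\<^esub> s' \<longrightarrow> c' = c)"
  proof
    fix c assume "c \<in> C"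
    then obtain g s where "g \<in> carrier G" "s \<in> S" "g = c \<otimes>\<^bsub>G\<^esub> s"
        "\<And>c' s'. c' \<in> C \<Longrightarrow> s' \<in> S \<Longrightarrow> g = c' \<otimes>\<^bsub>G\<^esub> s' \<Longrightarrow> c' = c"
      using minimal_left_complement_witness [OF min] by blast
    then show "\<exists>s. s \<in> S \<and> c \<otimes>\<^bsub>G\<^esub> s \<in> carrier G \<and>
        (\<forall>c'\<in>C. \<forall>s'\<in>S. c \<otimes>\<^bsub>G\<^esub> s = c' \<otimes>\<^bsub>G\<^esub> s' \<longrightarrow> c' = c)"
      by blast
  qed
  from bchoice [OF this] obtain s where s: "\<forall>c\<in>C. s c \<in> S \<and> c \<otimes>\<^bsub>G\<^esub> s c \<in> carrier G \<and>
      (\<forall>c'\<in>C. \<forall>s'\<in>S. c \<otimes>\<^bsub>G\<^esub> s c = c' \<otimes>\<^bsub>G\<^esub> s' \<longrightarrow> c' = c)"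
    by blast
  define g where "g c = c \<otimes>\<^bsub>G\<^esub> s c" for c
  have gs: "g c \<in> carrier G" "s c \<in> S" "g c = c \<otimes>\<^bsub>G\<^esub> s c"
      "c' \<in> C \<Longrightarrow> s' \<in> S \<Longrightarrow> g c = c' \<otimes>\<^bsub>G\<^esub> s' \<Longrightarrow> c' = c" if "c \<in> C" for c c' s'
    using s that by (auto simp: g_def)
  have "\<forall>K \<in> lcosets\<^bsub>G\<^esub> H. \<exists>r :: nat \<Rightarrow> 'a.
      (\<forall>i. r i \<in> S \<and> inv\<^bsub>G\<^esub> r i \<in> K) \<and> r 0 \<noteq> r 1"
  proof
    fix K assume "K \<in> lcosets\<^bsub>G\<^esub> H"
    then obtain t u where "t \<in> S" "u \<in> S" "t \<noteq> u" "inv\<^bsub>G\<^esub> t \<in> K" "inv\<^bsub>G\<^esub> u \<in> K"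
      using left_complement_meets_coset_twice [OF assms(2,3) comp] by blast
    then show "\<exists>r :: nat \<Rightarrow> 'a. (\<forall>i. r i \<in> S \<and> inv\<^bsub>G\<^esub> r i \<in> K) \<and> r 0 \<noteq> r 1"
      \<comment> \<open>Only the values at 0 and 1 matter later.\<close>
      by (intro exI [of _ "\<lambda>i. if i = 0 then t else u"]) simp
  qed
  from bchoice [OF this] obtain r :: "'a set \<Rightarrow> nat \<Rightarrow> 'a" where
    r: "\<forall>K \<in> lcosets\<^bsub>G\<^esub> H. (\<forall>i. r K i \<in> S \<and> inv\<^bsub>G\<^esub> r K i \<in> K) \<and> r K 0 \<noteq> r K 1"
    by blast
  define K where "K c = inv\<^bsub>G\<^esub> (g c) <#\<^bsub>G\<^esub> H" for c
  have K: "K c \<in> lcosets\<^bsub>G\<^esub> H" if "c \<in> C" for c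
    using gs(1) [OF that] by (auto simp: K_def LCOSETS_def)
  have rS: "r L i \<in> S" "inv\<^bsub>G\<^esub> r L i \<in> L" if "L \<in> lcosets\<^bsub>G\<^esub> H" for L i
    using r that by auto
  \<comment> \<open>The quotient \<open>h\<close> lies in \<open>H\<close> since both elements share
    a right coset. Were it in \<open>C\<close>, then \<open>h \<otimes> v\<close> would factor
    \<open>g c\<close>, forcing \<open>h = c\<close> and hence \<open>v = s c\<close>.\<close>
  have quot: "g c \<otimes>\<^bsub>G\<^esub> inv\<^bsub>G\<^esub> r (K c) i \<in> H - C"
    if c: "c \<in> C" and ne: "r (K c) i \<noteq> s c" for c i
  proof -
    define v where "v = r (K c) i"
    have v: "v \<in> S" "inv\<^bsub>G\<^esub> v \<in> K c" and vG: "v \<in> carrier G"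
      using rS [OF K [OF c]] S by (auto simp: v_def)
    have gG: "g c \<in> carrier G" using gs(1) c .
    obtain h where h: "h \<in> H" "inv\<^bsub>G\<^esub> v = inv\<^bsub>G\<^esub> (g c) \<otimes>\<^bsub>G\<^esub> h"
      using v by (auto simp: K_def l_coset_def)
    have "g c \<otimes>\<^bsub>G\<^esub> inv\<^bsub>G\<^esub> v = h"
      using h gG by (simp add: m_assoc [symmetric])
    moreover have gv: "g c = (g c \<otimes>\<^bsub>G\<^esub> inv\<^bsub>G\<^esub> v) \<otimes>\<^bsub>G\<^esub> v"
      using gG vG by (simp add: m_assoc)
    ultimately have ghv: "g c = h \<otimes>\<^bsub>G\<^esub> v" by simp
    have "h \<notin> C"
    proof
      assume "h \<in> C"
      then have "h = c" using gs(4) [OF c _ v(1) ghv] by simp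
      then have "c \<otimes>\<^bsub>G\<^esub> v = c \<otimes>\<^bsub>G\<^esub> s c" using ghv gs(3) [OF c] by simp
      moreover have "c \<in> carrier G" "s c \<in> carrier G"
        using c assms(3) gs(2) [OF c] S by auto
      ultimately have "v = s c" using vG by simp
      with ne show False by (simp add: v_def)
    qed
    with h \<open>g c \<otimes>\<^bsub>G\<^esub> inv\<^bsub>G\<^esub> v = h\<close> show ?thesis by (simp add: v_def)
  qed
  \<comment> \<open>At most one of the two distinct representatives equals \<open>s c\<close>; the
    index picks one that does not.\<close>
  define i where "i c = (if r (K c) 0 \<noteq> s c then 0 else 1 :: nat)" for c
  have ri: "r (K c) (i c) \<noteq> s c" if "c \<in> C" for c
    using r K [OF that] by (auto simp: i_def)
  define F where "F c = (i c, g c \<otimes>\<^bsub>G\<^esub> inv\<^bsub>G\<^esub> r (K c) (i c), K c)" for c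
  have FX: "F c \<in> ?X" if "c \<in> C" for c
    using quot [OF that ri [OF that]] K [OF that] by (auto simp: F_def i_def)
  have inj: "inj_on F C"
  proof (rule inj_onI)
    fix c d assume c: "c \<in> C" and d: "d \<in> C" and "F c = F d"
    then have "g c \<otimes>\<^bsub>G\<^esub> inv\<^bsub>G\<^esub> r (K c) (i c) = g d \<otimes>\<^bsub>G\<^esub> inv\<^bsub>G\<^esub> r (K c) (i c)"
      unfolding F_def by (metis Pair_inject)
    moreover have "r (K c) (i c) \<in> carrier G"
      using rS(1) [OF K [OF c]] S by auto
    ultimately have "g c = g d"
      using gs(1) c d by simp
    \<comment> \<open>Now \<open>c \<otimes> s c\<close> is a factorization of the witness
      \<open>g d\<close>, which only \<open>d\<close> can provide.\<close>
    then show "c = d"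
      using gs(4) [OF d c gs(2) [OF c]] gs(3) [OF c] by simp
  qed
  \<comment> \<open>A left inverse of the injection \<open>F\<close>, extended by \<open>c0\<close>,
    is the forbidden surjection onto \<open>C\<close>.\<close>
  define f where "f p = (if p \<in> F ` C then inv_into C F p else c0)" for p
  have "f ` ?X \<subseteq> C"
    using c0 inj by (auto simp: f_def)
  moreover have "c \<in> f ` ?X" if "c \<in> C" for c
  proof
    show "c = f (F c)" using inj that by (simp add: f_def)
    show "F c \<in> ?X" by (rule FX [OF that])
  qed
  ultimately have "f ` ?X = C" by blast
  with assms(4) show False by blast
qed

end
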